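(* Let $g(x)=bx+\int_0^\infty(1-e^{-sx})\,\nu(ds)$, $b\ge0$, be a Bernstein function whose Lévy measure $\nu$ has tail $w(s)=\nu((s,\infty))$ that is absolutely continuous on $(0,\infty)$ with $w(0+)=+\infty$. Let $\mathcal E_g$ be the inverse of the subordinator with Laplace exponent $g$, let $B$ be a standard real Brownian motion independent of $\mathcal E_g$, and put $\mathfrak B_g(t):=e^{iB(\mathcal E_g(t))}$, $t\ge0$. Let $U_g(\tau):=\mathbb E[\mathcal E_g(\tau)]$, $\tau\ge0$, and suppose that $\mathbb E[(\mathcal E_g(t))^k]<\infty$ for all $k\in\mathbb N$ and $t\ge 0$. Then, for $t,s\ge0$ with $t\ne s$, $$\mathbb E\big[\mathfrak B_g(t)\overline{\mathfrak B_g(s)}\big]=\mathbb E\,\mathfrak B_g(t\vee s)+\frac12\int_0^{t\wedge s}\mathbb E\,\mathfrak B_g(t\vee s-\tau)\,dU_g(\tau),$$ while $\mathbb E[\mathfrak B_g(t)\overline{\mathfrak B_g(t)}]=1$.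
   Context: A Lévy measure here is a non-negative measure $\nu$ on $(0,\infty)$ with $\int_0^\infty(z\wedge1)\,\nu(dz)<\infty$. $\mathcal H_g=\{\mathcal H_g(t)\}_{t\ge0}$ is the subordinator with drift $b$ and Lévy measure $\nu$, i.e. $\mathbb E e^{-\theta\mathcal H_g(t)}=e^{-tg(\theta)}$ for $\theta\ge0$. Its inverse is $\mathcal E_g(t)=\inf\{s>0:\mathcal H_g(s)>t\}$. The bar denotes complex conjugation, $t\vee s=\max\{t,s\}$, $t\wedge s=\min\{t,s\}$, and the integral with respect to $dU_g$ is a Lebesgue–Stieltjes integral. *)

theory Defs
  imports "HOL-Probability.Probability"
begin

definition levy_measure :: "real measure \<Rightarrow> bool" where
  "levy_measure \<nu> \<longleftrightarrow>
     sets \<nu> = sets (restrict_space borel {0<..}) \<and> (\<integral>\<^sup>+ z. ennreal (min z 1) \<partial>\<nu>) < \<infinity>"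

definition levy_tail :: "real measure \<Rightarrow> real \<Rightarrow> real" where
  "levy_tail \<nu> s = measure \<nu> {s<..}"

definition bernstein_fun :: "real \<Rightarrow> real measure \<Rightarrow> real \<Rightarrow> real" where
  "bernstein_fun b \<nu> x = b * x + (\<integral>s. (1 - exp (- (s * x))) \<partial>\<nu>)"

definition abs_continuous_between :: "real \<Rightarrow> real \<Rightarrow> (real \<Rightarrow> real) \<Rightarrow> bool" where
  "abs_continuous_between c d f \<longleftrightarrow>
     (\<forall>\<epsilon>>0. \<exists>\<delta>>0. \<forall>(n::nat) x y.
        (\<forall>i<n. c \<le> x i \<and> x i \<le> y i \<and> y i \<le> d) \<and>
        disjoint_family_on (\<lambda>i. {x i<..<y i}) {..<n} \<and>
        (\<Sum>i<n. y i - x i) < \<delta>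
        \<longrightarrow> (\<Sum>i<n. \<bar>f (y i) - f (x i)\<bar>) < \<epsilon>)"

text \<open>
  A function tending to infinity at 0 is not uniformly continuous on the open half line, so
  absolute continuity on it means absolute continuity on each compact subinterval.
\<close>

definition abs_continuous_on_pos :: "(real \<Rightarrow> real) \<Rightarrow> bool" where
  "abs_continuous_on_pos f \<longleftrightarrow> (\<forall>c d. 0 < c \<and> c < d \<longrightarrow> abs_continuous_between c d f)"

text \<open>
  Processes are maps \<open>real \<Rightarrow> 'a \<Rightarrow> real\<close> of which only the times \<open>t \<ge> 0\<close> matter. Path properties
  hold for every sample point. The left limits of the paths of a subordinator exist
  by monotonicity.
\<close>

definition (in prob_space) independent_increments :: "(real \<Rightarrow> 'a \<Rightarrow> real) \<Rightarrow> bool" where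
  "independent_increments X \<longleftrightarrow>
     (\<forall>(n::nat) t. 0 \<le> t 0 \<and> mono t \<longrightarrow>
        indep_vars (\<lambda>_. borel) (\<lambda>i \<omega>. X (t (Suc i)) \<omega> - X (t i) \<omega>) {..<n})"

locale subordinator = prob_space M for M :: "'a measure" +
  fixes H :: "real \<Rightarrow> 'a \<Rightarrow> real"
  assumes measurable_H: "\<And>t. 0 \<le> t \<Longrightarrow> random_variable borel (H t)"
    and H_zero: "\<And>\<omega>. \<omega> \<in> space M \<Longrightarrow> H 0 \<omega> = 0"
    and H_mono: "\<And>\<omega>. \<omega> \<in> space M \<Longrightarrow> mono_on {0..} (\<lambda>t. H t \<omega>)"
    and H_right_continuous:
      "\<And>\<omega> t. \<omega> \<in> space M \<Longrightarrow> 0 \<le> t \<Longrightarrow> continuous (at_right t) (\<lambda>u. H u \<omega>)"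
    and H_independent_increments: "independent_increments H"
    and H_stationary_increments:
      "\<And>t h. 0 \<le> t \<Longrightarrow> 0 \<le> h \<Longrightarrow> distr M borel (\<lambda>\<omega>. H (t + h) \<omega> - H t \<omega>) = distr M borel (H h)"

definition (in prob_space) has_laplace_exponent ::
    "(real \<Rightarrow> 'a \<Rightarrow> real) \<Rightarrow> (real \<Rightarrow> real) \<Rightarrow> bool" where
  "has_laplace_exponent H g \<longleftrightarrow>
     (\<forall>t\<ge>0. \<forall>\<theta>\<ge>0. expectation (\<lambda>\<omega>. exp (- (\<theta> * H t \<omega>))) = exp (- (t * g \<theta>)))"

locale brownian_motion = prob_space M for M :: "'a measure" +
  fixes B :: "real \<Rightarrow> 'a \<Rightarrow> real"
  assumes measurable_B: "\<And>t. 0 \<le> t \<Longrightarrow> random_variable borel (B t)"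
    and B_zero: "\<And>\<omega>. \<omega> \<in> space M \<Longrightarrow> B 0 \<omega> = 0"
    and B_continuous: "\<And>\<omega>. \<omega> \<in> space M \<Longrightarrow> continuous_on {0..} (\<lambda>t. B t \<omega>)"
    and B_independent_increments: "independent_increments B"
    and B_normal_increments:
      "\<And>s t. 0 \<le> s \<Longrightarrow> s < t \<Longrightarrow>
         distributed M lborel (\<lambda>\<omega>. B t \<omega> - B s \<omega>) (normal_density 0 (sqrt (t - s)))"

definition (in prob_space) indep_processes ::
    "(real \<Rightarrow> 'a \<Rightarrow> real) \<Rightarrow> (real \<Rightarrow> 'a \<Rightarrow> real) \<Rightarrow> bool" where
  "indep_processes X Y \<longleftrightarrow>
     indep_var (Pi\<^sub>M {0..} (\<lambda>_. borel)) (\<lambda>\<omega>. \<lambda>t\<in>{0..}. X t \<omega>)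
               (Pi\<^sub>M {0..} (\<lambda>_. borel)) (\<lambda>\<omega>. \<lambda>t\<in>{0..}. Y t \<omega>)"

text \<open>
  The first case occurs where the path of \<open>H\<close> never exceeds \<open>t\<close>, a null event for a non-zero
  Laplace exponent. The infimum would be infinite there; 0 is a dummy real value in the time domain
  of \<open>B\<close>.
\<close>

definition inverse_process :: "(real \<Rightarrow> 'a \<Rightarrow> real) \<Rightarrow> real \<Rightarrow> 'a \<Rightarrow> real" where
  "inverse_process H t \<omega> =
     (if {s. 0 < s \<and> t < H s \<omega>} = {} then 0 else Inf {s. 0 < s \<and> t < H s \<omega>})"

definition mean_inverse :: "'a measure \<Rightarrow> (real \<Rightarrow> 'a \<Rightarrow> real) \<Rightarrow> real \<Rightarrow> real" where
  "mean_inverse M H \<tau> = prob_space.expectation M (inverse_process H \<tau>)"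

definition circle_process ::
    "(real \<Rightarrow> 'a \<Rightarrow> real) \<Rightarrow> (real \<Rightarrow> 'a \<Rightarrow> real) \<Rightarrow> real \<Rightarrow> 'a \<Rightarrow> complex" where
  "circle_process B H t \<omega> = exp (\<i> * of_real (B (inverse_process H t \<omega>) \<omega>))"

text \<open>
  \<^const>\<open>interval_measure\<close> expects a distribution function on the whole line. The formula for
  \<^const>\<open>mean_inverse\<close> vanishes at negative arguments, so it already is the extension by zero
  of the function on the half line.
\<close>

lemma (in subordinator) mean_inverse_neg:
  assumes "\<tau> < 0"
  shows "mean_inverse M H \<tau> = 0"
proof -
  have "inverse_process H \<tau> \<omega> = 0" if "\<omega> \<in> space M" for \<omega>
  proof -
    have "\<tau> < H s \<omega>" if "0 < s" for s
      using mono_onD[OF H_mono[OF \<open>\<omega> \<in> space M\<close>], of 0 s] H_zero[OF \<open>\<omega> \<in> space M\<close>] that assms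
      by simp
    then have "{s. 0 < s \<and> \<tau> < H s \<omega>} = {0<..}" by auto
    then show ?thesis by (simp add: inverse_process_def)
  qed
  then have "expectation (inverse_process H \<tau>) = expectation (\<lambda>_. 0)"
    by (intro Bochner_Integration.integral_cong) auto
  then show ?thesis by (simp add: mean_inverse_def)
qed

end

theory Submission
  imports Defs
begin

text \<open>
  Let \<open>E\<close> be the inverse of \<open>H\<close>, \<open>c = 1/2\<close> and \<open>s \<le> t\<close>. Conditioning on \<open>E\<close> turns the left-hand side into
  the mean of \<open>exp (- c (E(t) - E(s)))\<close>. Pathwise this exponential is \<open>exp (- c E(t))\<close> plus \<open>c\<close> times
  the integral of \<open>exp (- c (E(t) - u))\<close> over \<open>0 \<le> u \<le> E(s)\<close>, and for almost every \<open>u\<close> the condition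
  \<open>u \<le> E(s)\<close> means \<open>H(u) \<le> s\<close>. On this event \<open>E(t) - u\<close> is the first passage time above the level
  \<open>t - H(u)\<close> of the increments of \<open>H\<close> after \<open>u\<close>, so by their independence of \<open>H(u)\<close> the exponential
  averages to \<open>f(t - H(u))\<close>, where \<open>f(r)\<close> is the mean of \<open>exp (- c E(r))\<close>. Integrating over \<open>u\<close>
  replaces the law of \<open>H(u)\<close> by the mean occupation measure of \<open>H\<close>, whose distribution function is
  the mean of \<open>E\<close>.
\<close>

section \<open>Measures determined by their distribution functions\<close>

text \<open>Monotonicity and right continuity of \<open>F\<close> are inherited from
  \<open>N\<close>, whose lower half lines have finite mass. So \<open>F\<close> is a genuine
  distribution function, and both measures give \<open>F b - F a\<close> to every half-open
  interval; these intervals form a generator stable under intersection.\<close>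

lemma interval_measure_eqI:
  fixes N :: "real measure" and F :: "real \<Rightarrow> real"
  assumes sets: "sets N = sets borel"
    and nonneg: "\<And>x. 0 \<le> F x"
    and F: "\<And>x. emeasure N {..x} = ennreal (F x)"
  shows "interval_measure F = N"
proof -
  note [measurable_cong] = sets
  have mono: "F x \<le> F y" if "x \<le> y" for x y
  proof -
    have "emeasure N {..x} \<le> emeasure N {..y}"
      using that by (intro emeasure_mono) (auto simp: sets)
    then show ?thesis by (simp add: F nonneg)
  qed
  have right: "continuous (at_right a) F" for a
    unfolding continuous_within
  proof (rule tendsto_at_right_sequentially[where b = "a + 1"])
    fix S :: "nat \<Rightarrow> real"
    assume S: "\<And>n. a < S n" "\<And>n. S n < a + 1" "decseq S" "S \<longlonglongrightarrow> a"
    \<comment> \<open>Continuity from above is available because every half line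
      \<open>{..S n}\<close> has the finite mass \<open>F (S n)\<close>.\<close>
    have "(\<lambda>n. emeasure N {..S n}) \<longlonglongrightarrow> emeasure N (\<Inter>n. {..S n})"
      using S(3) by (intro Lim_emeasure_decseq) (auto simp: sets F decseq_def intro: order_trans)
    also have "(\<Inter>n. {..S n}) = {..a}"
      using S(1) by (auto intro: LIMSEQ_le_const[OF S(4)] less_imp_le order_trans)
    finally show "(\<lambda>n. F (S n)) \<longlonglongrightarrow> F a"
      by (simp add: F nonneg)
  qed simp
  have Ioc: "emeasure N {a<..b} = ennreal (F b - F a)" if "a \<le> b" for a b
  proof -
    have "{a<..b} = {..b} - {..a}" using that by auto
    then have "emeasure N {a<..b} = emeasure N {..b} - emeasure N {..a}"
      using that by (simp add: emeasure_Diff F sets)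
    then show ?thesis by (simp add: F ennreal_minus nonneg)
  qed
  let ?E = "range (\<lambda>(a, b). {a<..b::real})"
  show ?thesis
  proof (rule measure_eqI_generator_eq[where E = ?E and \<Omega> = UNIV
        and A = "\<lambda>i. {- real i<..real i}"])
    show "Int_stable ?E"
      by (auto simp: Int_stable_def image_iff Int_greaterThanAtMost)
    fix X assume "X \<in> ?E"
    then obtain a b where X: "X = {a<..b}" by auto
    show "emeasure (interval_measure F) X = emeasure N X"
    proof (cases "a \<le> b")
      case True
      then show ?thesis
        by (simp add: X Ioc emeasure_interval_measure_Ioc mono right)
    qed (simp add: X)
  next
    show "(\<Union>i. {- real i<..real i}) = UNIV"
    proof -
      have "\<exists>i. - real i < x \<and> x \<le> real i" for x
        using reals_Archimedean2[of "\<bar>x\<bar>"] by (metis abs_less_iff less_imp_le minus_less_iff)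
      then show ?thesis by auto
    qed
  next
    fix i show "emeasure (interval_measure F) {- real i<..real i} \<noteq> \<infinity>"
      by (simp add: emeasure_interval_measure_Ioc mono right)
  qed (auto simp: sets borel_sigma_sets_Ioc)
qed

section \<open>Brownian increments between independent random times\<close>

text \<open>The index of the grid point of mesh 1/n just below \<open>x\<close>. The cap
  \<open>n * n\<close> leaves only finitely many values, so that an expectation over discretised
  times is a finite sum.\<close>

definition grid :: "nat \<Rightarrow> real \<Rightarrow> nat" where
  "grid n x = min (nat \<lfloor>real n * x\<rfloor>) (n * n)"

lemma measurable_grid [measurable]: "grid n \<in> borel \<rightarrow>\<^sub>M count_space UNIV"
  unfolding grid_def by measurable

text \<open>Once n is at least \<open>x\<close> the cap is inactive, and the rounding error is then
  at most 1/n.\<close>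

lemma grid_tendsto:
  assumes "0 \<le> x"
  shows "(\<lambda>n. real (grid n x) / real n) \<longlonglongrightarrow> x"
proof (rule tendsto_sandwich)
  have pos: "\<forall>\<^sub>F n in sequentially. 0 < n \<and> x \<le> real n"
    using eventually_gt_at_top[of "0::nat"] eventually_ge_at_top[of "nat \<lceil>x\<rceil>"]
    by eventually_elim linarith
  have eq: "\<forall>\<^sub>F n in sequentially. 0 < n \<and> real (grid n x) = of_int \<lfloor>real n * x\<rfloor>"
    using pos
  proof eventually_elim
    case (elim n)
    have "real n * x \<le> real n * real n" using elim by (intro mult_left_mono) auto
    then have "\<lfloor>real n * x\<rfloor> \<le> int (n * n)"
      by (metis floor_mono floor_of_nat of_nat_mult)
    then have "grid n x = nat \<lfloor>real n * x\<rfloor>"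
      by (simp only: grid_def nat_le_iff min_absorb1)
    then show ?case using elim assms by simp
  qed
  show "\<forall>\<^sub>F n in sequentially. x - 1 / real n \<le> real (grid n x) / real n"
    using eq
  proof eventually_elim
    case (elim n)
    have "(real n * x - 1) / real n \<le> real (grid n x) / real n"
      using elim by (intro divide_right_mono) linarith+
    then show ?case using elim by (simp add: diff_divide_distrib)
  qed
  show "\<forall>\<^sub>F n in sequentially. real (grid n x) / real n \<le> x"
    using eq by eventually_elim (simp add: field_simps)
  show "(\<lambda>n. x - 1 / real n) \<longlonglongrightarrow> x"
    using tendsto_diff[OF tendsto_const lim_1_over_n, of x] by simp
qed simp

context brownian_motion
begin

text \<open>This is the characteristic function of a centred normal variable of variance |a - b|,
  evaluated at 1 or -1.\<close>

lemma expectation_iexp_increment: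
  assumes "0 \<le> a" "0 \<le> b"
  shows "expectation (\<lambda>\<omega>. iexp (B a \<omega> - B b \<omega>)) = of_real (exp (- \<bar>a - b\<bar> / 2))"
proof -
  \<comment> \<open>The factor \<open>r\<close>, taken as 1 or -1, covers both orders of the two
    times with one computation.\<close>
  have std: "expectation (\<lambda>\<omega>. iexp (r * (B v \<omega> - B u \<omega>))) = of_real (exp (- (v - u) / 2))"
    if uv: "0 \<le> u" "u < v" and r: "r\<^sup>2 = 1" for u v r
  proof -
    let ?\<sigma> = "sqrt (v - u)"
    let ?Z = "\<lambda>\<omega>. (B v \<omega> - B u \<omega> - 0) / ?\<sigma>"
    have Z: "distributed M lborel ?Z std_normal_density"
      using B_normal_increments[OF uv] normal_standard_normal_convert[of ?\<sigma> _ 0] uv by auto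
    have [measurable]: "random_variable borel (B u)" "random_variable borel (B v)"
      using uv by (auto intro: measurable_B)
    have "expectation (\<lambda>\<omega>. iexp (r * (B v \<omega> - B u \<omega>))) =
        expectation (\<lambda>\<omega>. iexp ((r * ?\<sigma>) * ?Z \<omega>))"
      using uv by simp
    also have "\<dots> = char (distr M borel ?Z) (r * ?\<sigma>)"
      unfolding char_def by (subst integral_distr) auto
    also have "distr M borel ?Z = distr M lborel ?Z"
      by (intro distr_cong) auto
    also have "\<dots> = std_normal_distribution"
      using distributed_distr_eq_density[OF Z] by simp
    also have "char \<dots> (r * ?\<sigma>) = of_real (exp (- (v - u) / 2))"
      using uv r by (simp add: char_std_normal_distribution power_mult_distrib field_simps)
    finally show ?thesis .
  qed
  consider "a = b" | "a < b" | "b < a" by linarith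
  then show ?thesis
  proof cases
    case 1
    then show ?thesis by (simp add: prob_space)
  next
    case 2
    with std[of a b "-1"] assms show ?thesis by simp
  next
    case 3
    with std[of b a 1] assms show ?thesis by simp
  qed
qed

text \<open>The times are rounded to a grid. On each cell the increment is taken between fixed times
  and is independent of the cell indicator, so the expectation factors. Path continuity and bounded
  convergence remove the rounding. Independence is required from functions of \<open>X\<close> and
  \<open>Y\<close> jointly, since a cell indicator involves both.\<close>

lemma expectation_iexp_random_increment:
  assumes X [measurable]: "random_variable borel X" and Y [measurable]: "random_variable borel Y"
    and nonneg: "\<And>\<omega>. \<omega> \<in> space M \<Longrightarrow> 0 \<le> X \<omega>" "\<And>\<omega>. \<omega> \<in> space M \<Longrightarrow> 0 \<le> Y \<omega>"
    and indep: "\<And>a b f. 0 \<le> a \<Longrightarrow> 0 \<le> b \<Longrightarrow> f \<in> borel_measurable (borel \<Otimes>\<^sub>M borel) \<Longrightarrow>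
      indep_var borel (\<lambda>\<omega>. B a \<omega> - B b \<omega>) borel (\<lambda>\<omega>. f (X \<omega>, Y \<omega>) :: real)"
  shows "expectation (\<lambda>\<omega>. iexp (B (X \<omega>) \<omega> - B (Y \<omega>) \<omega>)) =
    of_real (expectation (\<lambda>\<omega>. exp (- \<bar>X \<omega> - Y \<omega>\<bar> / 2)))"
proof -
  define d where "d n x = real (grid n x) / real n" for n x
  have [measurable]: "d n \<in> borel_measurable borel" for n
    unfolding d_def by measurable
  have d0: "0 \<le> d n x" for n x by (simp add: d_def)
  have d: "(\<lambda>n. d n x) \<longlonglongrightarrow> x" if "0 \<le> x" for x
    using grid_tendsto[OF that] by (simp add: d_def)
  have [measurable]: "(\<lambda>\<omega>. B (real k / real n) \<omega>) \<in> borel_measurable M" for k n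
    by (rule measurable_B) simp
  \<comment> \<open>Evaluating the process at a countably valued random time is measurable; path
    continuity then carries measurability over to the times \<open>X\<close> and \<open>Y\<close>
    themselves.\<close>
  have [measurable]: "(\<lambda>\<omega>. B (d n (Z \<omega>)) \<omega>) \<in> borel_measurable M"
    if [measurable]: "random_variable borel Z" for n Z
    unfolding d_def by (rule measurable_compose_countable[where g = "\<lambda>\<omega>. grid n (Z \<omega>)"]) measurable
  have Bd: "(\<lambda>n. B (d n (Z \<omega>)) \<omega>) \<longlonglongrightarrow> B (Z \<omega>) \<omega>"
    if "\<omega> \<in> space M" "0 \<le> Z \<omega>" for Z \<omega>
    using that d0 by (intro continuous_on_tendsto_compose[OF B_continuous[OF that(1)] d]) auto
  have [measurable]: "(\<lambda>\<omega>. B (X \<omega>) \<omega>) \<in> borel_measurable M"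
    by (rule borel_measurable_LIMSEQ_metric[where f = "\<lambda>n \<omega>. B (d n (X \<omega>)) \<omega>"])
      (auto intro: Bd nonneg)
  have [measurable]: "(\<lambda>\<omega>. B (Y \<omega>) \<omega>) \<in> borel_measurable M"
    by (rule borel_measurable_LIMSEQ_metric[where f = "\<lambda>n \<omega>. B (d n (Y \<omega>)) \<omega>"])
      (auto intro: Bd nonneg)
  have discrete: "expectation (\<lambda>\<omega>. iexp (B (d n (X \<omega>)) \<omega> - B (d n (Y \<omega>)) \<omega>)) =
    expectation (\<lambda>\<omega>. of_real (exp (- \<bar>d n (X \<omega>) - d n (Y \<omega>)\<bar> / 2)))" for n
  proof -
    let ?J = "{..n * n} \<times> {..n * n}"
    let ?a = "\<lambda>j. real j / real n"
    let ?I = "\<lambda>j k x y. of_bool (grid n x = j \<and> grid n y = k) :: complex"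
    \<comment> \<open>Exactly one indicator in the sum is non-zero, and the cap in
      \<open>grid\<close> places its index pair inside \<open>?J\<close>.\<close>
    have pick: "(\<Sum>(j, k)\<in>?J. ?I j k x y * f (?a j) (?a k)) = f (d n x) (d n y)"
      for x y and f :: "real \<Rightarrow> real \<Rightarrow> complex"
    proof -
      have "(\<Sum>(j, k)\<in>?J. ?I j k x y * f (?a j) (?a k)) =
          (\<Sum>p\<in>{(grid n x, grid n y)}. case p of (j, k) \<Rightarrow> ?I j k x y * f (?a j) (?a k))"
        by (rule sum.mono_neutral_right) (auto simp: grid_def)
      then show ?thesis by (simp add: d_def)
    qed
    \<comment> \<open>On a cell the random factor \<open>iexp\<close> may be replaced by its mean,
      because the indicator is a function of \<open>X\<close> and \<open>Y\<close> alone.\<close>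
    have cell: "integrable M (\<lambda>\<omega>. ?I j k (X \<omega>) (Y \<omega>) * iexp (B (?a j) \<omega> - B (?a k) \<omega>))"
      "expectation (\<lambda>\<omega>. ?I j k (X \<omega>) (Y \<omega>) * iexp (B (?a j) \<omega> - B (?a k) \<omega>)) =
       expectation (\<lambda>\<omega>. ?I j k (X \<omega>) (Y \<omega>) * of_real (exp (- \<bar>?a j - ?a k\<bar> / 2)))" for j k
    proof -
      have "indep_var borel ((\<lambda>z. iexp z) \<circ> (\<lambda>\<omega>. B (?a j) \<omega> - B (?a k) \<omega>))
          borel (complex_of_real \<circ> (\<lambda>\<omega>. (\<lambda>(x, y). of_bool (grid n x = j \<and> grid n y = k)) (X \<omega>, Y \<omega>)))"
        by (rule indep_var_compose[OF indep]) (auto simp: of_bool_def)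
      moreover have "complex_of_real (of_bool P) = of_bool P" for P
        by (cases P) auto
      ultimately have i: "indep_var borel (\<lambda>\<omega>. iexp (B (?a j) \<omega> - B (?a k) \<omega>))
          borel (\<lambda>\<omega>. ?I j k (X \<omega>) (Y \<omega>))"
        by (simp add: comp_def)
      have 1: "integrable M (\<lambda>\<omega>. iexp (B (?a j) \<omega> - B (?a k) \<omega>))"
        by (intro integrable_const_bound[where B = 1]) auto
      have 2: "integrable M (\<lambda>\<omega>. ?I j k (X \<omega>) (Y \<omega>))"
        by (intro integrable_const_bound[where B = 1]) (auto simp: of_bool_def)
      show "integrable M (\<lambda>\<omega>. ?I j k (X \<omega>) (Y \<omega>) * iexp (B (?a j) \<omega> - B (?a k) \<omega>))"
        using indep_var_integrable[OF i 1 2] by (simp add: mult.commute)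
      have "expectation (\<lambda>\<omega>. iexp (B (?a j) \<omega> - B (?a k) \<omega>) * ?I j k (X \<omega>) (Y \<omega>)) =
        of_real (exp (- \<bar>?a j - ?a k\<bar> / 2)) * expectation (\<lambda>\<omega>. ?I j k (X \<omega>) (Y \<omega>))"
        using indep_var_lebesgue_integral[OF i 1 2] expectation_iexp_increment[of "?a j" "?a k"]
        by (simp only: zero_le_divide_iff of_nat_0_le_iff) simp
      then show "expectation (\<lambda>\<omega>. ?I j k (X \<omega>) (Y \<omega>) * iexp (B (?a j) \<omega> - B (?a k) \<omega>)) =
       expectation (\<lambda>\<omega>. ?I j k (X \<omega>) (Y \<omega>) * of_real (exp (- \<bar>?a j - ?a k\<bar> / 2)))"
        by (simp add: mult.commute)
    qed
    have "expectation (\<lambda>\<omega>. iexp (B (d n (X \<omega>)) \<omega> - B (d n (Y \<omega>)) \<omega>)) =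
      expectation (\<lambda>\<omega>. \<Sum>(j, k)\<in>?J. ?I j k (X \<omega>) (Y \<omega>) * iexp (B (?a j) \<omega> - B (?a k) \<omega>))"
      by (intro Bochner_Integration.integral_cong refl, rule pick[symmetric])
    also have "\<dots> = (\<Sum>(j, k)\<in>?J. expectation (\<lambda>\<omega>. ?I j k (X \<omega>) (Y \<omega>) * iexp (B (?a j) \<omega> - B (?a k) \<omega>)))"
      unfolding split_def by (rule Bochner_Integration.integral_sum) (rule cell(1))
    also have "\<dots> = (\<Sum>(j, k)\<in>?J. expectation (\<lambda>\<omega>. ?I j k (X \<omega>) (Y \<omega>) * of_real (exp (- \<bar>?a j - ?a k\<bar> / 2))))"
      by (simp only: cell(2))
    also have "\<dots> = expectation (\<lambda>\<omega>. \<Sum>(j, k)\<in>?J. ?I j k (X \<omega>) (Y \<omega>) * of_real (exp (- \<bar>?a j - ?a k\<bar> / 2)))"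
      unfolding split_def
      by (rule Bochner_Integration.integral_sum[symmetric])
        (intro integrable_const_bound[where B = 1], auto simp: of_bool_def norm_mult)
    also have "\<dots> = expectation (\<lambda>\<omega>. of_real (exp (- \<bar>d n (X \<omega>) - d n (Y \<omega>)\<bar> / 2)))"
      by (intro Bochner_Integration.integral_cong refl, rule pick)
    finally show ?thesis .
  qed
  have 1: "(\<lambda>n. expectation (\<lambda>\<omega>. iexp (B (d n (X \<omega>)) \<omega> - B (d n (Y \<omega>)) \<omega>))) \<longlonglongrightarrow>
    expectation (\<lambda>\<omega>. iexp (B (X \<omega>) \<omega> - B (Y \<omega>) \<omega>))"
    by (rule integral_dominated_convergence[where w = "\<lambda>_. 1"])
      (auto intro!: tendsto_intros Bd nonneg AE_I2)
  have 2: "(\<lambda>n. expectation (\<lambda>\<omega>. of_real (exp (- \<bar>d n (X \<omega>) - d n (Y \<omega>)\<bar> / 2)) :: complex)) \<longlonglongrightarrow>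
    expectation (\<lambda>\<omega>. of_real (exp (- \<bar>X \<omega> - Y \<omega>\<bar> / 2)))"
    by (rule integral_dominated_convergence[where w = "\<lambda>_. 1"])
      (auto intro!: tendsto_intros d nonneg AE_I2)
  show ?thesis
    using LIMSEQ_unique[OF 1[unfolded discrete] 2] by simp
qed

end

section \<open>Exponential integrals over the half line\<close>

text \<open>As predicates, indicators remain visibly measurable when the threshold itself varies
  with the integration variables.\<close>

lemma indicator_atMost: "indicator {..r} x = of_bool (x \<le> r)"
  by (simp add: indicator_def)

lemma indicator_greaterThan: "indicator {r<..} x = of_bool (r < x)"
  by (simp add: indicator_def)

abbreviation half_line :: "real measure" where
  "half_line \<equiv> density lborel (indicator {0..})"

lemma nn_integral_half_line:
  assumes [measurable]: "f \<in> borel_measurable borel"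
  shows "(\<integral>\<^sup>+u. f u \<partial>half_line) = (\<integral>\<^sup>+u. f u * indicator {0..} u \<partial>lborel)"
  by (simp add: nn_integral_density mult.commute)

lemma sigma_finite_half_line: "sigma_finite_measure half_line"
  by (subst sigma_finite_measure.sigma_finite_iff_density_finite[OF lborel.sigma_finite_measure_axioms]) (auto split: split_indicator)

text \<open>Discarding one point \<open>x\<close> serves to ignore the passage time itself, where
  the order between a path and its level is undecided.\<close>

lemma AE_half_line: "AE u in half_line. 0 \<le> u \<and> u \<noteq> x"
  by (subst AE_density) (use AE_lborel_singleton[of x] in \<open>auto split: split_indicator\<close>)

text \<open>The left side is the probability that an exponential time of rate \<open>c\<close> is at
  least \<open>x\<close>. Thus a Laplace transform of a passage time can be turned into an integral
  of probabilities of events.\<close>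

lemma ennreal_exp_exponential:
  assumes "0 < c" "0 \<le> x"
  shows "ennreal (exp (- (c * x))) = (\<integral>\<^sup>+v. ennreal (exponential_density c v) * indicator {x..} v \<partial>half_line)"
proof -
  have "(\<integral>\<^sup>+v. ennreal (exponential_density c v) * indicator {x..} v \<partial>half_line) =
      (\<integral>\<^sup>+v. ennreal (c * exp (- (c * v))) * indicator {x..} v \<partial>lborel)"
    using assms by (subst nn_integral_half_line, measurable, intro nn_integral_cong)
      (auto simp: exponential_density_def mult.commute split: split_indicator)
  also have "\<dots> = ennreal (0 - (- exp (- (c * x))))"
  proof (rule nn_integral_FTC_atLeast)
    show "((\<lambda>v. - exp (- (c * v))) has_real_derivative c * exp (- (c * v))) (at v)" for v
      by (auto intro!: derivative_eq_intros)
    have "((\<lambda>v. exp (- (c * v))) \<longlongrightarrow> 0) at_top"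
      using assms by real_asymp
    then show "((\<lambda>v. - exp (- (c * v))) \<longlongrightarrow> 0) at_top"
      using tendsto_minus by fastforce
  qed (use assms in auto)
  finally show ?thesis by simp
qed

text \<open>The fundamental theorem of calculus on [0, y], with u \<mapsto> exp (- c (x - u)) as
  antiderivative. It is applied with \<open>x\<close> and \<open>y\<close> the passage times of the
  upper and the lower level.\<close>

lemma ennreal_exp_diff:
  assumes "0 < c" "0 \<le> y"
  shows "ennreal (exp (- (c * (x - y)))) = ennreal (exp (- (c * x))) +
    ennreal c * (\<integral>\<^sup>+u. ennreal (exp (- (c * (x - u)))) * indicator {..y} u \<partial>half_line)"
proof -
  let ?I = "\<integral>\<^sup>+u. ennreal (exp (- (c * (x - u)))) * indicator {..y} u \<partial>half_line"
  have "ennreal c * ?I = (\<integral>\<^sup>+u. ennreal (c * exp (- (c * (x - u)))) * indicator {..y} u \<partial>half_line)"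
    using assms by (subst nn_integral_cmult[symmetric]) (auto simp: ennreal_mult' mult.assoc)
  also have "\<dots> = (\<integral>\<^sup>+u. ennreal (c * exp (- (c * (x - u)))) * indicator {0..y} u \<partial>lborel)"
    by (subst nn_integral_half_line) (auto intro!: nn_integral_cong split: split_indicator)
  also have "\<dots> = ennreal (exp (- (c * (x - y))) - exp (- (c * (x - 0))))"
    using assms by (intro nn_integral_FTC_Icc) (auto intro!: derivative_eq_intros)
  finally have "ennreal c * ?I = ennreal (exp (- (c * (x - y))) - exp (- (c * x)))"
    by simp
  moreover have "ennreal (exp (- (c * (x - y)))) =
      ennreal (exp (- (c * x))) + ennreal (exp (- (c * (x - y))) - exp (- (c * x)))"
    using assms by (subst ennreal_plus[symmetric]) auto
  ultimately show ?thesis by simp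
qed

section \<open>Paths of the subordinator and their passage times\<close>

context subordinator
begin

abbreviation "E \<equiv> inverse_process H"

text \<open>On this almost sure event every level is exceeded, so the dummy value 0 in
  \<open>inverse_process\<close> never comes into play.\<close>

definition transient :: bool where
  "transient \<longleftrightarrow> (AE \<omega> in M. \<forall>t. \<exists>s>0. t < H s \<omega>)"

lemma H_nonneg:
  assumes "\<omega> \<in> space M" "0 \<le> u"
  shows "0 \<le> H u \<omega>"
  using mono_onD[OF H_mono[OF assms(1)], of 0 u] H_zero[OF assms(1)] assms(2) by simp

text \<open>An exponential Markov bound: staying at or below m at the integer time n has probability
  at most exp m times exp (- n g(1)), which tends to 0 as n grows. Integer levels m suffice, so only
  countably many null events are discarded.\<close>

lemma transient_if_laplace_exponent:
  assumes g: "has_laplace_exponent H g" and pos: "0 < g 1"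
  shows transient
proof -
  have mom: "expectation (\<lambda>\<omega>. exp (- H s \<omega>)) = exp (- (s * g 1))" if "0 \<le> s" for s
    using g[unfolded has_laplace_exponent_def, rule_format, of s 1] that by simp
  have null: "AE \<omega> in M. \<exists>n. real m < H (real (Suc n)) \<omega>" for m :: nat
  proof -
    let ?A = "{\<omega> \<in> space M. \<forall>n. H (real (Suc n)) \<omega> \<le> real m}"
    have [measurable]: "H (real (Suc n)) \<in> borel_measurable M" for n
      by (rule measurable_H) simp
    have A: "?A \<in> events" by measurable
    have bound: "prob ?A \<le> exp (real m) * exp (- (real (Suc n) * g 1))" for n
    proof -
      have "exp (- real m) * prob ?A = expectation (\<lambda>\<omega>. exp (- real m) * indicator ?A \<omega>)"
        using A by simp
      also have "\<dots> \<le> expectation (\<lambda>\<omega>. exp (- H (real (Suc n)) \<omega>))"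
      proof (rule integral_mono)
        show "integrable M (\<lambda>\<omega>. exp (- H (real (Suc n)) \<omega>))"
          by (intro integrable_const_bound[where B = 1]) (auto intro!: AE_I2 H_nonneg simp del: of_nat_Suc)
        show "integrable M (\<lambda>\<omega>. exp (- real m) * indicator ?A \<omega>)"
          using A by (intro integrable_mult_right integrable_real_indicator) (auto simp: emeasure_eq_measure)
      qed (auto split: split_indicator)
      also have "\<dots> = exp (- (real (Suc n) * g 1))" by (rule mom) simp
      finally show ?thesis by (simp add: exp_minus field_simps)
    qed
    have "(\<lambda>n. exp (real m) * exp (- (real (Suc n) * g 1))) \<longlonglongrightarrow> 0"
      using pos by real_asymp
    then have "prob ?A \<le> 0"
      by (rule LIMSEQ_le_const) (use bound in auto)
    then have "emeasure M ?A = 0"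
      by (simp add: emeasure_eq_measure measure_nonneg order_antisym)
    then have "AE \<omega> in M. \<omega> \<notin> ?A"
      using A by (intro AE_not_in) auto
    then show ?thesis
      using AE_space by eventually_elim (auto simp: not_le)
  qed
  have "AE \<omega> in M. \<forall>m. \<exists>n. real m < H (real (Suc n)) \<omega>"
    using null by (simp add: AE_all_countable)
  then show ?thesis
    unfolding transient_def
  proof eventually_elim
    case (elim \<omega>)
    show ?case
    proof
      fix t
      obtain m where "t \<le> real m" using real_arch_simple by blast
      moreover obtain n where "real m < H (real (Suc n)) \<omega>" using elim by blast
      ultimately show "\<exists>s>0. t < H s \<omega>" by (intro exI[of _ "real (Suc n)"]) auto
    qed
  qed
qed

lemma inverse_process_nonneg: "0 \<le> E t \<omega>"
  by (auto simp: inverse_process_def intro!: cInf_greatest)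

text \<open>The two directions are separated because at u = E(t) the path may already have jumped
  above \<open>t\<close>: one direction needs strict inequality in \<open>u\<close>, the other
  yields only a weak one.\<close>

lemma
  assumes "\<omega> \<in> space M" "0 \<le> u" "\<exists>s>0. t < H s \<omega>"
  shows H_le_if_less_inverse: "0 \<le> t \<Longrightarrow> u < E t \<omega> \<Longrightarrow> H u \<omega> \<le> t"
    and le_inverse_if_H_le: "H u \<omega> \<le> t \<Longrightarrow> u \<le> E t \<omega>"
proof -
  have E: "E t \<omega> = Inf {s. 0 < s \<and> t < H s \<omega>}"
    using assms(3) by (auto simp: inverse_process_def)
  have bdd: "bdd_below {s. 0 < s \<and> t < H s \<omega>}"
    by (rule bdd_belowI[of _ 0]) auto
  show "H u \<omega> \<le> t" if "0 \<le> t" "u < E t \<omega>"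
  proof (rule ccontr)
    assume *: "\<not> H u \<omega> \<le> t"
    \<comment> \<open>The infimum runs over positive times only; time 0 is excluded here since
      \<open>H\<close> starts at 0, which does not exceed the level \<open>t\<close>.\<close>
    then have "u \<noteq> 0" using H_zero[OF assms(1)] that by auto
    then have "E t \<omega> \<le> u"
      unfolding E using * assms(2) by (intro cInf_lower bdd) auto
    then show False using that by simp
  qed
  show "u \<le> E t \<omega>" if "H u \<omega> \<le> t"
    unfolding E
  proof (rule cInf_greatest)
    fix s assume s: "s \<in> {s. 0 < s \<and> t < H s \<omega>}"
    show "u \<le> s"
    proof (rule ccontr)
      assume "\<not> u \<le> s"
      then have "H s \<omega> \<le> H u \<omega>"
        using s assms(2) by (intro mono_onD[OF H_mono[OF assms(1)]]) auto
      then show False using s that by auto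
    qed
  qed (use assms(3) in auto)
qed

text \<open>A higher level shrinks the set of exceedance times. That \<open>t\<close> is exceeded
  keeps the smaller set non-empty, so that \<open>E t \<omega>\<close> is a true infimum.\<close>

lemma inverse_process_mono:
  assumes "\<omega> \<in> space M" "s \<le> t" "\<exists>u>0. t < H u \<omega>"
  shows "E s \<omega> \<le> E t \<omega>"
  using assms(2,3) by (auto simp: inverse_process_def intro!: cInf_superset_mono bdd_belowI[of _ 0])

text \<open>\<^term>\<open>max 0 u\<close> makes the time variable range over the whole line, where \<^term>\<open>H\<close> is unspecified
  at negative times.\<close>

lemma measurable_H_pair [measurable]:
  "(\<lambda>(u, \<omega>). H (max 0 u) \<omega>) \<in> borel_measurable (borel \<Otimes>\<^sub>M M)"
proof (rule borel_measurable_LIMSEQ_metric)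
  \<comment> \<open>These grid points lie strictly to the right of \<open>max 0 u\<close> and
    converge to it, which is what right continuity of the paths requires; negative \<open>u\<close>
    gives points tending to 0.\<close>
  define d where "d n u = real (nat \<lfloor>real (Suc n) * u\<rfloor> + 1) / real (Suc n)" for n u
  have [measurable]: "H (real k / real n) \<in> borel_measurable M" for k n
    by (rule measurable_H) simp
  show "(\<lambda>(u, \<omega>). H (d n u) \<omega>) \<in> borel_measurable (borel \<Otimes>\<^sub>M M)" for n
    unfolding d_def split_def
    by (rule measurable_compose_countable[where g = "\<lambda>(u, \<omega>). nat \<lfloor>real (Suc n) * u\<rfloor> + 1"
          and f = "\<lambda>k (u, \<omega>). H (real k / real (Suc n)) \<omega>", simplified split_def]) measurable
  fix p :: "real \<times> 'a" assume "p \<in> space (borel \<Otimes>\<^sub>M M)"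
  then obtain u \<omega> where p: "p = (u, \<omega>)" "\<omega> \<in> space M"
    by (auto simp: space_pair_measure)
  have real_nat: "real (nat \<lfloor>real (Suc n) * u\<rfloor>) = of_int \<lfloor>real (Suc n) * max 0 u\<rfloor>" for n
  proof (cases "0 \<le> u")
    case False
    then have "real (Suc n) * u \<le> 0" by (simp add: mult_le_0_iff)
    then have "\<lfloor>real (Suc n) * u\<rfloor> \<le> 0" by linarith
    with False show ?thesis by (simp only: nat_0_iff[THEN iffD2]) simp
  qed simp
  have d_alt: "d n u = (of_int \<lfloor>real (Suc n) * max 0 u\<rfloor> + 1) / real (Suc n)" for n
    by (simp only: d_def of_nat_add of_nat_1 real_nat)
  have gt: "max 0 u < d n u" for n
  proof -
    have "real (Suc n) * max 0 u / real (Suc n) < d n u"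
      unfolding d_alt by (intro divide_strict_right_mono) linarith+
    then show ?thesis by (simp del: of_nat_Suc)
  qed
  have le: "d n u \<le> max 0 u + 1 / real (Suc n)" for n
  proof -
    have "d n u \<le> (real (Suc n) * max 0 u + 1) / real (Suc n)"
      unfolding d_alt by (intro divide_right_mono) linarith+
    then show ?thesis by (simp add: add_divide_distrib del: of_nat_Suc)
  qed
  have "(\<lambda>n. d n u) \<longlonglongrightarrow> max 0 u"
  proof (rule tendsto_sandwich[where f = "\<lambda>_. max 0 u"])
    show "(\<lambda>n. max 0 u + 1 / real (Suc n)) \<longlonglongrightarrow> max 0 u"
      using tendsto_add[OF tendsto_const LIMSEQ_inverse_real_of_nat, of "max 0 u"]
      by (simp add: inverse_eq_divide)
  qed (use gt le in \<open>auto intro: less_imp_le eventuallyI simp del: of_nat_Suc\<close>)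
  then have "filterlim (\<lambda>n. d n u) (at_right (max 0 u)) sequentially"
    unfolding filterlim_at using gt by (auto intro!: eventuallyI less_imp_neq[THEN not_sym])
  moreover have "((\<lambda>v. H v \<omega>) \<longlongrightarrow> H (max 0 u) \<omega>) (at_right (max 0 u))"
    using H_right_continuous[OF p(2), of "max 0 u"] by (simp add: continuous_within)
  ultimately have "(\<lambda>n. H (d n u) \<omega>) \<longlonglongrightarrow> H (max 0 u) \<omega>"
    by (rule filterlim_compose[rotated])
  then show "(\<lambda>n. case p of (u, \<omega>) \<Rightarrow> H (d n u) \<omega>) \<longlonglongrightarrow> (case p of (u, \<omega>) \<Rightarrow> H (max 0 u) \<omega>)"
    by (simp add: p)
qed

lemma measurable_H_compose [measurable (raw)]:
  assumes [measurable]: "f \<in> borel_measurable N" "g \<in> N \<rightarrow>\<^sub>M M"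
  shows "(\<lambda>x. H (max 0 (f x)) (g x)) \<in> borel_measurable N"
  using measurable_compose[OF measurable_Pair[OF assms] measurable_H_pair] by simp

lemma H_le_iff:
  assumes "\<omega> \<in> space M" "0 \<le> u" "\<exists>s>0. t < H s \<omega>" "0 \<le> t" "u \<noteq> E t \<omega>"
  shows "H u \<omega> \<le> t \<longleftrightarrow> u < E t \<omega>"
  using H_le_if_less_inverse[OF assms(1-3)] le_inverse_if_H_le[OF assms(1-3)] assms(4,5) by fastforce

section \<open>The mean occupation measure\<close>

sublocale half_line: sigma_finite_measure half_line
  by (rule sigma_finite_half_line)

sublocale half_line_M: pair_sigma_finite half_line M
  by unfold_locales

text \<open>The mean time that the paths spend in a set, also known as the potential or renewal
  measure of the subordinator. As an image of a product measure it reduces integrals to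
  Fubini.\<close>

definition occupation_measure :: "real measure" where
  "occupation_measure = distr (half_line \<Otimes>\<^sub>M M) borel (\<lambda>(u, \<omega>). H (max 0 u) \<omega>)"

lemma sets_occupation_measure [simp, measurable_cong]: "sets occupation_measure = sets borel"
  by (simp add: occupation_measure_def)

lemma nn_integral_occupation_measure:
  assumes [measurable]: "f \<in> borel_measurable borel"
  shows "(\<integral>\<^sup>+\<tau>. f \<tau> \<partial>occupation_measure) = (\<integral>\<^sup>+u. \<integral>\<^sup>+\<omega>. f (H (max 0 u) \<omega>) \<partial>M \<partial>half_line)"
proof -
  have "(\<integral>\<^sup>+\<tau>. f \<tau> \<partial>occupation_measure) =
      (\<integral>\<^sup>+p. f (case p of (u, \<omega>) \<Rightarrow> H (max 0 u) \<omega>) \<partial>(half_line \<Otimes>\<^sub>M M))"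
    unfolding occupation_measure_def by (rule nn_integral_distr) measurable
  also have "\<dots> = (\<integral>\<^sup>+u. \<integral>\<^sup>+\<omega>. f (H (max 0 u) \<omega>) \<partial>M \<partial>half_line)"
    by (subst nn_integral_fst[symmetric]) simp_all
  finally show ?thesis .
qed

text \<open>Up to the single time E(x), a path is at or below level \<open>x\<close> exactly during
  [0, E(x)). Hence by Fubini the mean occupation time of that half line is the mean of E(x).\<close>

lemma interval_measure_mean_inverse:
  assumes trans: transient and int: "\<And>t. 0 \<le> t \<Longrightarrow> integrable M (E t)"
  shows "interval_measure (mean_inverse M H) = occupation_measure"
proof (rule interval_measure_eqI)
  fix x :: real
  show nonneg: "0 \<le> mean_inverse M H x"
    by (simp add: mean_inverse_def inverse_process_nonneg)
  have *: "emeasure occupation_measure {..x} =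
      (\<integral>\<^sup>+u. \<integral>\<^sup>+\<omega>. indicator {..x} (H (max 0 u) \<omega>) \<partial>M \<partial>half_line)"
    using nn_integral_occupation_measure[of "indicator {..x}"] by simp
  show "emeasure occupation_measure {..x} = ennreal (mean_inverse M H x)"
  proof (cases "0 \<le> x")
    \<comment> \<open>Below level 0 both sides vanish, as the paths are non-negative and
      \<open>mean_inverse\<close> is zero at negative arguments.\<close>
    case False
    then have "\<not> H (max 0 u) \<omega> \<le> x" if "\<omega> \<in> space M" for u \<omega>
      using H_nonneg[OF that, of "max 0 u"] by auto
    then have "(\<integral>\<^sup>+\<omega>. indicator {..x} (H (max 0 u) \<omega>) \<partial>M) = (\<integral>\<^sup>+\<omega>. 0 \<partial>M)" for u
      by (intro nn_integral_cong) auto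
    with False show ?thesis by (simp add: * mean_inverse_neg)
  next
    case True
    note *
    also have "(\<integral>\<^sup>+u. \<integral>\<^sup>+\<omega>. indicator {..x} (H (max 0 u) \<omega>) \<partial>M \<partial>half_line) =
        (\<integral>\<^sup>+\<omega>. \<integral>\<^sup>+u. indicator {..x} (H (max 0 u) \<omega>) \<partial>half_line \<partial>M)"
      by (rule half_line_M.Fubini'[symmetric]) measurable
    also have "\<dots> = (\<integral>\<^sup>+\<omega>. ennreal (E x \<omega>) \<partial>M)"
    proof (rule nn_integral_cong_AE)
      show "AE \<omega> in M. (\<integral>\<^sup>+u. indicator {..x} (H (max 0 u) \<omega>) \<partial>half_line) = ennreal (E x \<omega>)"
        using trans[unfolded transient_def] AE_space
      proof eventually_elim
        case (elim \<omega>)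
        have "(\<integral>\<^sup>+u. indicator {..x} (H (max 0 u) \<omega>) \<partial>half_line) = (\<integral>\<^sup>+u. indicator {..<E x \<omega>} u \<partial>half_line)"
        proof (rule nn_integral_cong_AE)
          show "AE u in half_line. (indicator {..x} (H (max 0 u) \<omega>) :: ennreal) = indicator {..<E x \<omega>} u"
            using AE_half_line[of "E x \<omega>"]
            by eventually_elim (use H_le_iff[of \<omega> _ x] elim True in \<open>auto split: split_indicator simp: max_def\<close>)
        qed
        also have "\<dots> = (\<integral>\<^sup>+u. indicator {0..<E x \<omega>} u \<partial>lborel)"
          by (subst nn_integral_half_line, measurable, rule nn_integral_cong) (auto split: split_indicator)
        finally show ?case by (simp add: inverse_process_nonneg)
      qed
    qed
    also have "\<dots> = ennreal (mean_inverse M H x)"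
      unfolding mean_inverse_def
      by (rule nn_integral_eq_integral[OF int[OF True]]) (simp add: inverse_process_nonneg)
    finally show ?thesis .
  qed
qed simp

section \<open>Restarting the subordinator at a fixed time\<close>

text \<open>The simple Markov property: \<open>H u\<close> and the increment after \<open>u\<close>
  have a product law, and by stationarity the increment is distributed as
  \<open>H v\<close>.\<close>

lemma nn_integral_increments:
  assumes "0 \<le> u" "0 \<le> v" and [measurable]: "f \<in> borel_measurable (borel \<Otimes>\<^sub>M borel)"
  shows "(\<integral>\<^sup>+\<omega>. f (H u \<omega>, H (u + v) \<omega>) \<partial>M) = (\<integral>\<^sup>+\<omega>. \<integral>\<^sup>+\<omega>'. f (H u \<omega>, H u \<omega> + H v \<omega>') \<partial>M \<partial>M)"
proof -
  have [measurable]: "random_variable borel (H u)" "random_variable borel (H v)"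
      "random_variable borel (H (u + v))"
    using assms by (auto intro: measurable_H)
  let ?D = "\<lambda>\<omega>. H (u + v) \<omega> - H u \<omega>"
  \<comment> \<open>The partition 0, u, u + v is continued as a constant to stay monotone; its first
    two increments are the ones needed.\<close>
  define t where "t n = (if n = 0 then 0 else if n = 1 then u else u + v)" for n :: nat
  have "0 \<le> t 0 \<and> mono t"
    using assms by (auto simp: t_def mono_def)
  then have "indep_vars (\<lambda>_. borel) (\<lambda>i \<omega>. H (t (Suc i)) \<omega> - H (t i) \<omega>) {..<2}"
    using H_independent_increments unfolding independent_increments_def by blast
  moreover have "{..<2} = insert 0 {1::nat}" by auto
  ultimately have "indep_var borel (\<lambda>\<omega>. H u \<omega> - H 0 \<omega>) borel ?D"
    using indep_vars_sum[of "{1::nat}" 0 "\<lambda>i \<omega>. H (t (Suc i)) \<omega> - H (t i) \<omega>"] by (simp add: t_def)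
  moreover have "distr M borel (\<lambda>\<omega>. H u \<omega> - H 0 \<omega>) = distr M borel (H u)"
    by (rule distr_cong) (auto simp: H_zero)
  moreover have "distr M (borel \<Otimes>\<^sub>M borel) (\<lambda>\<omega>. (H u \<omega> - H 0 \<omega>, ?D \<omega>)) =
      distr M (borel \<Otimes>\<^sub>M borel) (\<lambda>\<omega>. (H u \<omega>, ?D \<omega>))"
    by (rule distr_cong) (auto simp: H_zero)
  ultimately have prod: "distr M borel (H u) \<Otimes>\<^sub>M distr M borel (H v) =
      distr M (borel \<Otimes>\<^sub>M borel) (\<lambda>\<omega>. (H u \<omega>, ?D \<omega>))"
    using H_stationary_increments[of u v] assms by (simp add: indep_var_distribution_eq)
  interpret v: prob_space "distr M borel (H v)" by (rule prob_space_distr) simp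
  have "(\<integral>\<^sup>+\<omega>. f (H u \<omega>, H (u + v) \<omega>) \<partial>M) =
      (\<integral>\<^sup>+p. f (fst p, fst p + snd p) \<partial>distr M (borel \<Otimes>\<^sub>M borel) (\<lambda>\<omega>. (H u \<omega>, ?D \<omega>)))"
    by (subst nn_integral_distr) simp_all
  also have "\<dots> = (\<integral>\<^sup>+x. \<integral>\<^sup>+y. f (x, x + y) \<partial>distr M borel (H v) \<partial>distr M borel (H u))"
    unfolding prod[symmetric] by (subst v.nn_integral_fst[symmetric]) simp_all
  also have "\<dots> = (\<integral>\<^sup>+\<omega>. \<integral>\<^sup>+\<omega>'. f (H u \<omega>, H u \<omega> + H v \<omega>') \<partial>M \<partial>M)"
    by (simp add: nn_integral_distr)
  finally show ?thesis .
qed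

text \<open>For a transient subordinator, c > 0 and r \<ge> 0 this is the Laplace transform at
  \<open>c\<close> of the passage time above \<open>r\<close>. Writing it through \<open>H\<close>
  makes measurability in \<open>r\<close> evident and gives it a meaning for every real
  \<open>r\<close>.\<close>

definition exit_laplace :: "real \<Rightarrow> real \<Rightarrow> ennreal" where
  "exit_laplace c r = (\<integral>\<^sup>+v. ennreal (exponential_density c v) *
     (\<integral>\<^sup>+\<omega>. indicator {r<..} (H (max 0 v) \<omega>) \<partial>M) \<partial>half_line)"

lemma measurable_exit_laplace [measurable]: "exit_laplace c \<in> borel_measurable borel"
  unfolding exit_laplace_def indicator_greaterThan by measurable

text \<open>An exponential time \<open>v\<close> of rate \<open>c\<close> is at least E(t) - u
  precisely when H(u + v) exceeds \<open>t\<close>, apart from one value of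
  \<open>v\<close>.\<close>

lemma exp_inverse_process:
  assumes "\<omega> \<in> space M" "\<exists>s>0. t < H s \<omega>" "0 < c" "0 \<le> t" "0 \<le> u" "u \<le> E t \<omega>"
  shows "ennreal (exp (- (c * (E t \<omega> - u)))) =
    (\<integral>\<^sup>+v. ennreal (exponential_density c v) * indicator {t<..} (H (max 0 (u + v)) \<omega>) \<partial>half_line)"
proof -
  have "ennreal (exp (- (c * (E t \<omega> - u)))) =
      (\<integral>\<^sup>+v. ennreal (exponential_density c v) * indicator {E t \<omega> - u..} v \<partial>half_line)"
    using assms by (intro ennreal_exp_exponential) auto
  also have "\<dots> = (\<integral>\<^sup>+v. ennreal (exponential_density c v) * indicator {t<..} (H (max 0 (u + v)) \<omega>) \<partial>half_line)"
  proof (rule nn_integral_cong_AE)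
    show "AE v in half_line. ennreal (exponential_density c v) * indicator {E t \<omega> - u..} v =
        ennreal (exponential_density c v) * indicator {t<..} (H (max 0 (u + v)) \<omega>)"
      using AE_half_line[of "E t \<omega> - u"]
    proof eventually_elim
      case (elim v)
      then have "H (u + v) \<omega> \<le> t \<longleftrightarrow> u + v < E t \<omega>"
        using assms by (intro H_le_iff) auto
      then show ?case using elim assms by (auto split: split_indicator)
    qed
  qed
  finally show ?thesis .
qed

lemma exit_laplace_eq:
  assumes trans: transient and c: "0 < c" and t: "0 \<le> t"
  shows "exit_laplace c t = (\<integral>\<^sup>+\<omega>. ennreal (exp (- (c * E t \<omega>))) \<partial>M)"
proof -
  have "(\<integral>\<^sup>+\<omega>. ennreal (exp (- (c * E t \<omega>))) \<partial>M) =
    (\<integral>\<^sup>+\<omega>. \<integral>\<^sup>+v. ennreal (exponential_density c v) * indicator {t<..} (H (max 0 v) \<omega>) \<partial>half_line \<partial>M)"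
    using trans[unfolded transient_def] AE_space
    by (intro nn_integral_cong_AE, eventually_elim)
      (use exp_inverse_process[of _ t c 0] c t in \<open>auto simp: inverse_process_nonneg\<close>)
  also have "\<dots> = (\<integral>\<^sup>+v. \<integral>\<^sup>+\<omega>. ennreal (exponential_density c v) * indicator {t<..} (H (max 0 v) \<omega>) \<partial>M \<partial>half_line)"
    by (rule half_line_M.Fubini') measurable
  also have "\<dots> = exit_laplace c t"
    unfolding exit_laplace_def by (intro nn_integral_cong nn_integral_cmult) measurable
  finally show ?thesis by simp
qed

text \<open>Both passage times are first expressed by events of \<open>H\<close>: \<open>u\<close>
  is before E(s) when H(u) \<le> s, and the exponential becomes an exponential clock
  \<open>v\<close> with H(u + v) > t. Restarting at \<open>u\<close> then leaves only the law of
  H(u), and integrating over \<open>u\<close> produces the occupation measure.\<close>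

lemma nn_integral_exp_before_exit:
  assumes trans: transient and c: "0 < c" and st: "0 \<le> s" "s \<le> t"
  shows "(\<integral>\<^sup>+\<omega>. \<integral>\<^sup>+u. ennreal (exp (- (c * (E t \<omega> - u)))) * indicator {..E s \<omega>} u \<partial>half_line \<partial>M) =
    (\<integral>\<^sup>+\<tau>. exit_laplace c (t - \<tau>) * indicator {0..s} \<tau> \<partial>occupation_measure)"
proof -
  let ?e = "\<lambda>v. ennreal (exponential_density c v)"
  \<comment> \<open>This kernel mentions only the values of \<open>H\<close> at \<open>u\<close> and
    \<open>u + v\<close>, the form to which Fubini and the Markov property apply.\<close>
  let ?k = "\<lambda>\<omega> u v. indicator {0..s} (H (max 0 u) \<omega>) * (?e v * indicator {t<..} (H (max 0 (u + v)) \<omega>)) :: ennreal"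
  have "(\<integral>\<^sup>+\<omega>. \<integral>\<^sup>+u. ennreal (exp (- (c * (E t \<omega> - u)))) * indicator {..E s \<omega>} u \<partial>half_line \<partial>M) =
      (\<integral>\<^sup>+\<omega>. \<integral>\<^sup>+u. \<integral>\<^sup>+v. ?k \<omega> u v \<partial>half_line \<partial>half_line \<partial>M)"
  proof (rule nn_integral_cong_AE)
    show "AE \<omega> in M. (\<integral>\<^sup>+u. ennreal (exp (- (c * (E t \<omega> - u)))) * indicator {..E s \<omega>} u \<partial>half_line) =
        (\<integral>\<^sup>+u. \<integral>\<^sup>+v. ?k \<omega> u v \<partial>half_line \<partial>half_line)"
      using trans[unfolded transient_def] AE_space
    proof eventually_elim
      case (elim \<omega>)
      have le: "E s \<omega> \<le> E t \<omega>"
        using elim st by (intro inverse_process_mono) auto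
      show ?case
      proof (rule nn_integral_cong_AE)
        show "AE u in half_line. ennreal (exp (- (c * (E t \<omega> - u)))) * indicator {..E s \<omega>} u =
            (\<integral>\<^sup>+v. ?k \<omega> u v \<partial>half_line)"
          using AE_half_line[of "E s \<omega>"]
        proof eventually_elim
          case (elim u)
          have "H u \<omega> \<le> s \<longleftrightarrow> u < E s \<omega>"
            using elim \<open>\<forall>t. \<exists>s>0. t < H s \<omega>\<close> \<open>\<omega> \<in> space M\<close> st by (intro H_le_iff) auto
          then have "indicator {0..s} (H (max 0 u) \<omega>) = (indicator {..E s \<omega>} u :: ennreal)"
            using elim H_nonneg[OF \<open>\<omega> \<in> space M\<close>, of u] by (auto split: split_indicator)
          moreover have "ennreal (exp (- (c * (E t \<omega> - u)))) =
              (\<integral>\<^sup>+v. ?e v * indicator {t<..} (H (max 0 (u + v)) \<omega>) \<partial>half_line)" if "u \<le> E s \<omega>"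
            using elim that le st c \<open>\<forall>t. \<exists>s>0. t < H s \<omega>\<close> \<open>\<omega> \<in> space M\<close>
            by (intro exp_inverse_process) auto
          ultimately show ?case
            by (cases "u \<le> E s \<omega>") auto
        qed
      qed
    qed
  qed
  also have "\<dots> = (\<integral>\<^sup>+u. \<integral>\<^sup>+\<omega>. \<integral>\<^sup>+v. ?k \<omega> u v \<partial>half_line \<partial>M \<partial>half_line)"
    by (rule half_line_M.Fubini') measurable
  also have "\<dots> = (\<integral>\<^sup>+u. \<integral>\<^sup>+\<omega>. exit_laplace c (t - H (max 0 u) \<omega>) * indicator {0..s} (H (max 0 u) \<omega>) \<partial>M \<partial>half_line)"
  proof (rule nn_integral_cong_AE)
    show "AE u in half_line. (\<integral>\<^sup>+\<omega>. \<integral>\<^sup>+v. ?k \<omega> u v \<partial>half_line \<partial>M) =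
        (\<integral>\<^sup>+\<omega>. exit_laplace c (t - H (max 0 u) \<omega>) * indicator {0..s} (H (max 0 u) \<omega>) \<partial>M)"
      using AE_half_line[of 0]
    proof eventually_elim
      case (elim u)
      have "(\<integral>\<^sup>+\<omega>. \<integral>\<^sup>+v. ?k \<omega> u v \<partial>half_line \<partial>M) = (\<integral>\<^sup>+v. \<integral>\<^sup>+\<omega>. ?k \<omega> u v \<partial>M \<partial>half_line)"
        by (rule half_line_M.Fubini') measurable
      \<comment> \<open>Here \<open>\<omega>'\<close> is the sample point of an independent copy:
        exceeding \<open>t\<close> at time u + v means that the copy exceeds the remaining height t
        - H(u) at time \<open>v\<close>.\<close>
      also have "\<dots> = (\<integral>\<^sup>+v. \<integral>\<^sup>+\<omega>. \<integral>\<^sup>+\<omega>'. indicator {0..s} (H (max 0 u) \<omega>) *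
          (?e v * indicator {t - H (max 0 u) \<omega><..} (H (max 0 v) \<omega>')) \<partial>M \<partial>M \<partial>half_line)"
      proof (rule nn_integral_cong_AE)
        show "AE v in half_line. (\<integral>\<^sup>+\<omega>. ?k \<omega> u v \<partial>M) =
          (\<integral>\<^sup>+\<omega>. \<integral>\<^sup>+\<omega>'. indicator {0..s} (H (max 0 u) \<omega>) *
            (?e v * indicator {t - H (max 0 u) \<omega><..} (H (max 0 v) \<omega>')) \<partial>M \<partial>M)"
          using AE_half_line[of 0]
        proof eventually_elim
          case (elim v)
          have eq: "(indicator {t - x<..} y :: ennreal) = indicator {t<..} (x + y)" for x y
            by (auto split: split_indicator)
          show ?case
            using nn_integral_increments[of u v "\<lambda>(x, y). indicator {0..s} x * (?e v * indicator {t<..} y)"]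
              elim \<open>0 \<le> u \<and> u \<noteq> 0\<close> by (simp add: eq max_def)
        qed
      qed
      also have "\<dots> = (\<integral>\<^sup>+\<omega>. \<integral>\<^sup>+v. \<integral>\<^sup>+\<omega>'. indicator {0..s} (H (max 0 u) \<omega>) *
          (?e v * indicator {t - H (max 0 u) \<omega><..} (H (max 0 v) \<omega>')) \<partial>M \<partial>half_line \<partial>M)"
        unfolding indicator_greaterThan by (rule half_line_M.Fubini'[symmetric]) measurable
      also have "\<dots> = (\<integral>\<^sup>+\<omega>. exit_laplace c (t - H (max 0 u) \<omega>) * indicator {0..s} (H (max 0 u) \<omega>) \<partial>M)"
      proof (rule nn_integral_cong)
        fix \<omega> assume "\<omega> \<in> space M"
        have "(\<integral>\<^sup>+v. \<integral>\<^sup>+\<omega>'. (?e v * indicator {t - x<..} (H (max 0 v) \<omega>')) \<partial>M \<partial>half_line) = exit_laplace c (t - x)" for x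
          unfolding exit_laplace_def by (intro nn_integral_cong nn_integral_cmult) measurable
        then show "(\<integral>\<^sup>+v. \<integral>\<^sup>+\<omega>'. indicator {0..s} (H (max 0 u) \<omega>) *
          (?e v * indicator {t - H (max 0 u) \<omega><..} (H (max 0 v) \<omega>')) \<partial>M \<partial>half_line) =
          exit_laplace c (t - H (max 0 u) \<omega>) * indicator {0..s} (H (max 0 u) \<omega>)"
          by (cases "H (max 0 u) \<omega> \<in> {0..s}") auto
      qed
      finally show ?case .
    qed
  qed
  also have "\<dots> = (\<integral>\<^sup>+\<tau>. exit_laplace c (t - \<tau>) * indicator {0..s} \<tau> \<partial>occupation_measure)"
    by (rule nn_integral_occupation_measure[symmetric]) measurable
  finally show ?thesis .
qed

text \<open>The mean of the pathwise identity \<open>ennreal_exp_diff\<close>. The computation runs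
  in extended non-negative reals, and finiteness is recovered at the end.\<close>

lemma expectation_exp_inverse_increment:
  assumes trans: transient and int: "\<And>t. 0 \<le> t \<Longrightarrow> integrable M (E t)"
    and c: "0 < c" and st: "0 \<le> s" "s \<le> t"
  shows "expectation (\<lambda>\<omega>. exp (- (c * (E t \<omega> - E s \<omega>)))) = expectation (\<lambda>\<omega>. exp (- (c * E t \<omega>))) +
    c * (LINT \<tau>:{0..s}|interval_measure (mean_inverse M H). expectation (\<lambda>\<omega>. exp (- (c * E (t - \<tau>) \<omega>))))"
    (is "?L = ?R + c * ?J")
proof -
  have [measurable]: "E t \<in> borel_measurable M" "E s \<in> borel_measurable M"
    using int[of t] int[of s] st by auto
  have int_exp: "integrable M (\<lambda>\<omega>. exp (- (c * E r \<omega>)))" if "0 \<le> r" for r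
    using int[OF that] c
    by (intro integrable_const_bound[where B = 1]) (auto simp: inverse_process_nonneg)
  have exit: "exit_laplace c r = ennreal (expectation (\<lambda>\<omega>. exp (- (c * E r \<omega>))))" if "0 \<le> r" for r
    unfolding exit_laplace_eq[OF trans c that]
    by (rule nn_integral_eq_integral[OF int_exp[OF that]]) simp
  let ?K = "\<integral>\<^sup>+\<tau>. exit_laplace c (t - \<tau>) * indicator {0..s} \<tau> \<partial>occupation_measure"
  \<comment> \<open>For a non-negative measurable integrand this holds before finiteness of
    \<open>?K\<close> is known, both sides being 0 in the infinite case.\<close>
  have J: "?J = enn2real ?K"
  proof -
    let ?f = "\<lambda>\<tau>. indicator {0..s} \<tau> *\<^sub>R expectation (\<lambda>\<omega>. exp (- (c * E (t - \<tau>) \<omega>)))"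
    \<comment> \<open>Passing to \<open>exit_laplace\<close> supplies the measurability in
      \<tau>.\<close>
    have f: "?f \<tau> = indicator {0..s} \<tau> *\<^sub>R enn2real (exit_laplace c (t - \<tau>))" for \<tau>
      using st by (auto simp: exit integral_nonneg_AE split: split_indicator)
    have "interval_measure (mean_inverse M H) = occupation_measure"
      by (rule interval_measure_mean_inverse[OF trans]) (rule int)
    then have "?J = enn2real (\<integral>\<^sup>+\<tau>. ennreal (?f \<tau>) \<partial>occupation_measure)"
      unfolding set_lebesgue_integral_def
    proof (simp only:, intro integral_eq_nn_integral)
      show "?f \<in> borel_measurable occupation_measure"
        unfolding f by measurable
    qed auto
    also have "(\<integral>\<^sup>+\<tau>. ennreal (?f \<tau>) \<partial>occupation_measure) = ?K"
      using st by (intro nn_integral_cong) (auto simp: exit split: split_indicator)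
    finally show ?thesis .
  qed
  have "(\<integral>\<^sup>+\<omega>. ennreal (exp (- (c * (E t \<omega> - E s \<omega>)))) \<partial>M) =
      (\<integral>\<^sup>+\<omega>. ennreal (exp (- (c * E t \<omega>))) + ennreal c *
        (\<integral>\<^sup>+u. ennreal (exp (- (c * (E t \<omega> - u)))) * indicator {..E s \<omega>} u \<partial>half_line) \<partial>M)"
    using c by (intro nn_integral_cong ennreal_exp_diff inverse_process_nonneg)
  also have "\<dots> = ennreal ?R + ennreal c * ?K"
  proof -
    have [measurable]: "(\<lambda>\<omega>. \<integral>\<^sup>+u. ennreal (exp (- (c * (E t \<omega> - u)))) * indicator {..E s \<omega>} u \<partial>half_line)
        \<in> borel_measurable M"
      unfolding indicator_atMost by measurable
    show ?thesis
      by (simp add: nn_integral_add nn_integral_cmult nn_integral_exp_before_exit[OF trans c st]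
          nn_integral_eq_integral[OF int_exp] st order_trans[OF st])
  qed
  finally have eq: "(\<integral>\<^sup>+\<omega>. ennreal (exp (- (c * (E t \<omega> - E s \<omega>)))) \<partial>M) = ennreal ?R + ennreal c * ?K" .
  have "AE \<omega> in M. E s \<omega> \<le> E t \<omega>"
    using trans[unfolded transient_def] AE_space
    by eventually_elim (use st in \<open>auto intro: inverse_process_mono\<close>)
  then have bound: "AE \<omega> in M. exp (- (c * (E t \<omega> - E s \<omega>))) \<le> 1"
    by eventually_elim (use c in auto)
  have "(\<integral>\<^sup>+\<omega>. ennreal (exp (- (c * (E t \<omega> - E s \<omega>)))) \<partial>M) = ennreal ?L"
    by (intro nn_integral_eq_integral integrable_const_bound[where B = 1]) (use bound in auto)
  with eq have L: "ennreal ?L = ennreal ?R + ennreal c * ?K" by simp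
  \<comment> \<open>The left-hand side is a real number, so the summand containing \<open>?K\<close>
    cannot be infinite.\<close>
  then have "ennreal c * ?K \<noteq> \<top>"
    by (metis ennreal_add_eq_top ennreal_neq_top)
  then have "?K < \<top>"
    using c by (auto simp: ennreal_mult_eq_top_iff less_top)
  then have "ennreal ?L = ennreal (?R + c * enn2real ?K)"
    using L c by (simp add: ennreal_mult integral_nonneg_AE)
  then have "?L = ?R + c * enn2real ?K"
    using c by (subst (asm) ennreal_inj) (auto simp: integral_nonneg_AE)
  then show ?thesis by (simp add: J)
qed

end

section \<open>Positivity of the Laplace exponent\<close>

text \<open>The integrand 1 - exp (- s x) is strictly positive on the half line, so a vanishing
  integral would make the measure null, against its unbounded tail.\<close>

lemma bernstein_fun_pos:
  assumes "0 \<le> b" "levy_measure \<nu>" "filterlim (levy_tail \<nu>) at_top (at_right 0)" "0 < x"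
  shows "0 < bernstein_fun b \<nu> x"
proof -
  have sets: "sets \<nu> = sets (restrict_space borel {0<..})"
    and fin: "(\<integral>\<^sup>+z. ennreal (min z 1) \<partial>\<nu>) < \<infinity>"
    using assms(2) by (auto simp: levy_measure_def)
  have space: "space \<nu> = {0<..}"
    using sets_eq_imp_space_eq[OF sets] by (simp add: space_restrict_space)
  have meas: "f \<in> borel_measurable \<nu>" if "f \<in> borel_measurable borel" for f :: "real \<Rightarrow> real"
    using measurable_restrict_space1[OF that, of "{0<..}"] measurable_cong_sets[OF sets refl] by blast
  have min_int: "integrable \<nu> (\<lambda>z. min z 1)"
    using fin by (intro integrableI_nonneg meas) (auto simp: space)
  \<comment> \<open>Integrability must come first, as the Bochner integral of a non-integrable
    function is 0 by convention. The constant \<open>max x 1\<close> arises from bounding 1 - exp (-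
    s x) by both s x and 1.\<close>
  have int: "integrable \<nu> (\<lambda>s. 1 - exp (- (s * x)))"
  proof (rule Bochner_Integration.integrable_bound)
    show "integrable \<nu> (\<lambda>z. max x 1 * min z 1)" using min_int by simp
    show "AE s in \<nu>. norm (1 - exp (- (s * x))) \<le> norm (max x 1 * min s 1)"
    proof (rule AE_I2)
      fix s assume "s \<in> space \<nu>"
      then have s: "0 < s" by (simp add: space)
      have "1 - exp (- (s * x)) \<le> s * x" using exp_ge_add_one_self[of "- (s * x)"] by linarith
      moreover have "1 - exp (- (s * x)) \<le> 1" by simp
      moreover have "s * x \<le> s * max x 1" using s by simp
      moreover have "0 \<le> 1 - exp (- (s * x))" using s assms(4) by simp
      moreover have "1 \<le> max x 1" by simp
      ultimately have "1 - exp (- (s * x)) \<le> max x 1 * min s 1"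
        by (cases "s \<le> 1") (simp_all only: min_absorb1 min_absorb2 not_le less_imp_le mult.commute[of _ s] mult_1_right)
      then show "norm (1 - exp (- (s * x))) \<le> norm (max x 1 * min s 1)"
        using \<open>0 \<le> 1 - exp (- (s * x))\<close> by simp
    qed
  qed (rule meas, measurable)
  have nonneg: "AE s in \<nu>. 0 \<le> 1 - exp (- (s * x))"
    using assms(4) by (intro AE_I2) (auto simp: space)
  have "(\<integral>s. (1 - exp (- (s * x))) \<partial>\<nu>) \<noteq> 0"
  proof
    assume "(\<integral>s. (1 - exp (- (s * x))) \<partial>\<nu>) = 0"
    then have "AE s in \<nu>. 1 - exp (- (s * x)) = 0"
      using integral_nonneg_eq_0_iff_AE[OF int nonneg] by simp
    then have "AE s in \<nu>. False"
      using AE_space by eventually_elim (use assms(4) in \<open>auto simp: space\<close>)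
    then have "emeasure \<nu> (space \<nu>) = 0"
      by (simp add: AE_iff_measurable[OF sets.top])
    then have "levy_tail \<nu> s = 0" if "0 < s" for s
      using emeasure_mono[OF _ sets.top, of "{s<..}" \<nu>] that
      by (auto simp: levy_tail_def measure_def space)
    moreover have "\<forall>\<^sub>F s in at_right 0. 1 \<le> levy_tail \<nu> s \<and> 0 < s"
      using assms(3) eventually_at_right_less[of "0::real"]
      by (auto simp: filterlim_at_top intro: eventually_conj)
    then obtain s where "1 \<le> levy_tail \<nu> s" "0 < s"
      using eventually_happens[of _ "at_right (0::real)"] by auto
    ultimately show False by fastforce
  qed
  moreover have "0 \<le> (\<integral>s. (1 - exp (- (s * x))) \<partial>\<nu>)"
    by (rule integral_nonneg_AE[OF nonneg])
  ultimately show ?thesis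
    using assms(1,4) by (simp add: bernstein_fun_def add_nonneg_pos)
qed

section \<open>Correlations of the circle-valued process\<close>

theorem theorem4p2:
  fixes M :: "'a measure"
    and b :: real and \<nu> :: "real measure"
    and H B :: "real \<Rightarrow> 'a \<Rightarrow> real"
  assumes "0 \<le> b"
    and "levy_measure \<nu>"
    and "abs_continuous_on_pos (levy_tail \<nu>)"
    and "filterlim (levy_tail \<nu>) at_top (at_right 0)"
    and "subordinator M H"
    and "prob_space.has_laplace_exponent M H (bernstein_fun b \<nu>)"
    and "brownian_motion M B"
    and "prob_space.indep_processes M B (inverse_process H)"
    and "\<And>(k::nat) t. 0 \<le> t \<Longrightarrow> integrable M (\<lambda>\<omega>. inverse_process H t \<omega> ^ k)"
  shows "(\<forall>t\<ge>0. \<forall>s\<ge>0. t \<noteq> s \<longrightarrow>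
            prob_space.expectation M (\<lambda>\<omega>. circle_process B H t \<omega> * cnj (circle_process B H s \<omega>)) =
              prob_space.expectation M (circle_process B H (max t s)) +
              1 / 2 * (LINT \<tau>:{0..min t s}|interval_measure (mean_inverse M H).
                         prob_space.expectation M (circle_process B H (max t s - \<tau>))))
       \<and> (\<forall>t\<ge>0.
            prob_space.expectation M (\<lambda>\<omega>. circle_process B H t \<omega> * cnj (circle_process B H t \<omega>)) = 1)"
proof -
  interpret subordinator M H by fact
  interpret brownian_motion M B by fact
  have trans: transient
    using transient_if_laplace_exponent[OF assms(6)] bernstein_fun_pos[OF assms(1,2,4)] by simp
  have int: "integrable M (E t)" if "0 \<le> t" for t
    using assms(9)[OF that, of 1] by simp
  have [measurable]: "random_variable borel (E t)" if "0 \<le> t" for t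
    using int[OF that] by simp
  \<comment> \<open>Both variables are functions of finitely many coordinates of the two independent
    path maps.\<close>
  have indep: "indep_var borel (\<lambda>\<omega>. B a \<omega> - B a' \<omega>) borel (\<lambda>\<omega>. f (E t \<omega>, E s \<omega>))"
    if "0 \<le> a" "0 \<le> a'" "0 \<le> t" "0 \<le> s" and [measurable]: "f \<in> borel_measurable (borel \<Otimes>\<^sub>M borel)"
    for a a' t s and f :: "real \<times> real \<Rightarrow> real"
  proof -
    have "indep_var borel ((\<lambda>p. p a - p a') \<circ> (\<lambda>\<omega>. \<lambda>t\<in>{0..}. B t \<omega>))
        borel ((\<lambda>p. f (p t, p s)) \<circ> (\<lambda>\<omega>. \<lambda>t\<in>{0..}. E t \<omega>))"
      using assms(8)[unfolded indep_processes_def]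
      by (rule indep_var_compose) (use that in
        \<open>auto intro!: borel_measurable_diff measurable_component_singleton measurable_compose[OF _ that(5)]\<close>)
    then show ?thesis using that by (simp add: comp_def)
  qed
  have cnj_eq: "circle_process B H t \<omega> * cnj (circle_process B H s \<omega>) = iexp (B (E t \<omega>) \<omega> - B (E s \<omega>) \<omega>)"
    for t s \<omega>
    by (simp add: circle_process_def exp_cnj algebra_simps flip: exp_add)
  \<comment> \<open>By monotonicity of the passage times, |E(t) - E(s)| is almost surely the
    increment from the smaller to the larger level.\<close>
  have two: "expectation (\<lambda>\<omega>. circle_process B H t \<omega> * cnj (circle_process B H s \<omega>)) =
      of_real (expectation (\<lambda>\<omega>. exp (- (1 / 2 * (E (max t s) \<omega> - E (min t s) \<omega>)))))"
    if ts: "0 \<le> t" "0 \<le> s" for t s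
  proof -
    have "AE \<omega> in M. E (min t s) \<omega> \<le> E (max t s) \<omega>"
      using trans[unfolded transient_def] AE_space
      by eventually_elim (rule inverse_process_mono, assumption, simp, blast)
    then have "AE \<omega> in M. exp (- \<bar>E t \<omega> - E s \<omega>\<bar> / 2) = exp (- (1 / 2 * (E (max t s) \<omega> - E (min t s) \<omega>)))"
      by eventually_elim (auto simp: max_def min_def split: if_splits)
    then have "expectation (\<lambda>\<omega>. exp (- \<bar>E t \<omega> - E s \<omega>\<bar> / 2)) =
        expectation (\<lambda>\<omega>. exp (- (1 / 2 * (E (max t s) \<omega> - E (min t s) \<omega>))))"
      using ts by (intro integral_cong_AE) auto
    moreover have "expectation (\<lambda>\<omega>. iexp (B (E t \<omega>) \<omega> - B (E s \<omega>) \<omega>)) =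
        of_real (expectation (\<lambda>\<omega>. exp (- \<bar>E t \<omega> - E s \<omega>\<bar> / 2)))"
      using ts by (intro expectation_iexp_random_increment indep inverse_process_nonneg) auto
    ultimately show ?thesis by (simp only: cnj_eq)
  qed
  have one: "expectation (circle_process B H t) = of_real (expectation (\<lambda>\<omega>. exp (- (1 / 2 * E t \<omega>))))"
    if t: "0 \<le> t" for t
  proof -
    \<comment> \<open>A single time is handled as the pair of E(t) and the constant 0, since B(0) =
      0.\<close>
    have zero: "indep_var borel (\<lambda>\<omega>. B a \<omega> - B a' \<omega>) borel (\<lambda>\<omega>. f (E t \<omega>, 0))"
      if "0 \<le> a" "0 \<le> a'" and [measurable]: "f \<in> borel_measurable (borel \<Otimes>\<^sub>M borel)"
      for a a' and f :: "real \<times> real \<Rightarrow> real"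
      using indep[OF that(1,2) t t, of "\<lambda>p. f (fst p, 0)"] by simp
    have "expectation (circle_process B H t) = expectation (\<lambda>\<omega>. iexp (B (E t \<omega>) \<omega> - B 0 \<omega>))"
      by (rule Bochner_Integration.integral_cong) (auto simp: circle_process_def B_zero)
    also have "\<dots> = of_real (expectation (\<lambda>\<omega>. exp (- \<bar>E t \<omega> - 0\<bar> / 2)))"
      using t by (intro expectation_iexp_random_increment zero inverse_process_nonneg) auto
    finally show ?thesis by (simp add: inverse_process_nonneg)
  qed
  have "expectation (\<lambda>\<omega>. circle_process B H t \<omega> * cnj (circle_process B H s \<omega>)) =
      expectation (circle_process B H (max t s)) +
      1 / 2 * (LINT \<tau>:{0..min t s}|interval_measure (mean_inverse M H).
        expectation (circle_process B H (max t s - \<tau>)))" if ts: "0 \<le> t" "0 \<le> s" for t s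
  proof -
    \<comment> \<open>On the range of integration the argument \<open>max t s - \<tau>\<close> is
      non-negative, so \<open>one\<close> applies and the integrand becomes real.\<close>
    have "(LINT \<tau>:{0..min t s}|interval_measure (mean_inverse M H).
          expectation (circle_process B H (max t s - \<tau>))) =
        (LINT \<tau>:{0..min t s}|interval_measure (mean_inverse M H).
          complex_of_real (expectation (\<lambda>\<omega>. exp (- (1 / 2 * E (max t s - \<tau>) \<omega>)))))"
    proof (intro set_lebesgue_integral_cong allI impI)
      fix \<tau> assume "\<tau> \<in> {0..min t s}"
      then show "expectation (circle_process B H (max t s - \<tau>)) =
          of_real (expectation (\<lambda>\<omega>. exp (- (1 / 2 * E (max t s - \<tau>) \<omega>))))"
        by (intro one) auto
    qed simp
    moreover have "expectation (\<lambda>\<omega>. exp (- (1 / 2 * (E (max t s) \<omega> - E (min t s) \<omega>)))) =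
        expectation (\<lambda>\<omega>. exp (- (1 / 2 * E (max t s) \<omega>))) +
        1 / 2 * (LINT \<tau>:{0..min t s}|interval_measure (mean_inverse M H).
          expectation (\<lambda>\<omega>. exp (- (1 / 2 * E (max t s - \<tau>) \<omega>))))"
      using ts by (intro expectation_exp_inverse_increment trans int) auto
    moreover have "0 \<le> max t s" using ts by simp
    ultimately show ?thesis
      by (simp only: two[OF ts] one set_integral_complex_of_real of_real_add of_real_mult) simp
  qed
  moreover have "expectation (\<lambda>\<omega>. circle_process B H t \<omega> * cnj (circle_process B H t \<omega>)) = 1" for t
    by (simp add: cnj_eq prob_space)
  ultimately show ?thesis by blast
qed

end
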